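(* Let $q\ge2$ be an integer and let $i$ be an integer with $0\le i<q$. Then the function $\phi$ is constant on the interval $\left[\frac{i}{q},\frac{i}{q-1}\right]$ (intersected with $[0,1)$), and on this interval $$\phi(c)=\frac{\log(q-i)}{\log q}.$$
   Context: For an integer $q\ge2$ and $c\in[0,1)$ let $F_c^q=\{x\in[0,1) : \{q^nx\}\ge c\text{ for all integers } n\ge0\}$, where $\{\cdot\}$ denotes the fractional part, and let $\phi(c)=\dim_H F_c^q$ be its Hausdorff dimension. *)

theory Defs
  imports "HOL-Analysis.Analysis"
begin

(* The value diam(U)^s, with the usual conventions diam({})^s = 0 for every s (including s = 0)
   and diam(U)^0 = 1 for nonempty U. The case s = 0 is separate because 0 powr 0 = 0.
   Only meaningful for bounded U, since diameter returns 0 on unbounded sets. *)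
definition diam_pow :: "real \<Rightarrow> 'a::metric_space set \<Rightarrow> ennreal" where
  "diam_pow s U =
    (if U = {} then 0 else if s = 0 then 1 else ennreal (diameter U powr s))"

(* Finite covers are included, by padding with empty sets. *)
definition delta_covers :: "real \<Rightarrow> 'a::metric_space set \<Rightarrow> (nat \<Rightarrow> 'a set) set" where
  "delta_covers \<delta> A =
    {U. A \<subseteq> (\<Union>n. U n) \<and> (\<forall>n. bounded (U n) \<and> diameter (U n) \<le> \<delta>)}"

definition hausdorff_premeasure :: "real \<Rightarrow> real \<Rightarrow> 'a::metric_space set \<Rightarrow> ennreal" where
  "hausdorff_premeasure s \<delta> A = (INF U \<in> delta_covers \<delta> A. \<Sum>n. diam_pow s (U n))"

(* The premeasure is antimonotone in \<delta>, so the limit \<delta> \<rightarrow> 0 is a supremum. *)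
definition hausdorff_measure :: "real \<Rightarrow> 'a::metric_space set \<Rightarrow> ennreal" where
  "hausdorff_measure s A = (SUP \<delta> \<in> {0<..}. hausdorff_premeasure s \<delta> A)"

(* Takes values in [0, \<infinity>]; the empty set has dimension 0. *)
definition hausdorff_dim :: "'a::metric_space set \<Rightarrow> ereal" where
  "hausdorff_dim A = (INF s \<in> {s. 0 \<le> s \<and> hausdorff_measure s A = 0}. ereal s)"

definition F :: "int \<Rightarrow> real \<Rightarrow> real set" where
  "F q c = {x \<in> {0..<1}. \<forall>n::nat. frac (of_int q ^ n * x) \<ge> c}"

definition phi :: "int \<Rightarrow> real \<Rightarrow> ereal" where
  "phi q c = hausdorff_dim (F q c)"

end

theory Submission
  imports Defs
begin

text \<open>
  Read points of \<open>[0,1)\<close> in base \<open>q\<close>. If \<open>c \<ge> i/q\<close>, every digit of a point of \<open>F q c\<close> is at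
  least \<open>i\<close>, so \<open>N = q - i\<close> choices remain per digit. Hence \<open>F q c\<close> is covered by \<open>N ^ n\<close>
  intervals of length \<open>q ^ -n\<close>, and its dimension is at most \<open>ln N / ln q\<close>
  (\<open>dim_F_le\<close>).

  If \<open>c \<le> i/(q-1)\<close>, which is the number \<open>0.iii...\<close> in base \<open>q\<close>, then conversely every digit
  sequence with values in \<open>{i..<q}\<close> that is not eventually \<open>q - 1\<close> gives a point of \<open>F q c\<close>.
  The map \<open>shifted\<close> produces these points: expand \<open>y \<in> [0,1)\<close> in base \<open>N\<close>, add \<open>i\<close> to each
  digit, and read the result in base \<open>q\<close>. Its values cannot be close together unless the arguments
  are: \<open>\<bar>x - y\<bar>\<close> is at most a constant times
  \<open>\<bar>shifted x - shifted y\<bar> powr (ln N / ln q)\<close> (\<open>inverse_Hoelder_shifted\<close>). A cover of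
  \<open>F q c\<close> therefore pulls back to a cover of \<open>[0,1)\<close>, whose total length is at least \<open>1\<close>, and
  this keeps the Hausdorff sums away from \<open>0\<close> (\<open>hausdorff_dim_ge_of_inverse_Hoelder\<close>). No
  measure has to be constructed on \<open>F q c\<close>; Lebesgue measure on the parameter interval does the work.

  For \<open>N = 1\<close> the parametrization is degenerate, but then the claimed dimension is \<open>0\<close>, a
  trivial lower bound.
\<close>

section \<open>Estimating Hausdorff dimension\<close>

lemma hausdorff_dim_leI:
  assumes "\<And>s. s > d \<Longrightarrow> hausdorff_measure s A = 0" and "0 \<le> d"
  shows "hausdorff_dim A \<le> ereal d"
proof (rule ereal_le_epsilon2)
  fix e :: real assume e: "0 < e"
  have "hausdorff_dim A \<le> ereal (d + e)"
    unfolding hausdorff_dim_def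
    by (rule INF_lower) (use assms e in auto)
  then show "hausdorff_dim A \<le> ereal d + ereal e" by simp
qed

lemma hausdorff_dim_geI:
  assumes "\<And>s. 0 \<le> s \<Longrightarrow> hausdorff_measure s A = 0 \<Longrightarrow> d \<le> s"
  shows "ereal d \<le> hausdorff_dim A"
  unfolding hausdorff_dim_def by (rule INF_greatest) (use assms in auto)

lemma diam_pow_le:
  assumes "0 < s" "0 \<le> r" "bounded U" "diameter U \<le> r"
  shows "diam_pow s U \<le> ennreal (r powr s)"
  using assms diameter_ge_0[of U]
  by (auto simp: diam_pow_def intro!: ennreal_leI powr_mono2)

lemma hausdorff_premeasure_le_finite_cover:
  fixes C :: "'a::metric_space set set"
  assumes "0 < s" "0 \<le> r" "r \<le> \<delta>" "finite C" "A \<subseteq> \<Union>C"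
    and C: "\<And>U. U \<in> C \<Longrightarrow> bounded U \<and> diameter U \<le> r"
  shows "hausdorff_premeasure s \<delta> A \<le> ennreal (real (card C) * r powr s)"
proof -
  obtain f where f: "bij_betw f {..<card C} C"
    using ex_bij_betw_nat_finite[OF \<open>finite C\<close>] by (auto simp: atLeast0LessThan)
  define V where "V m = (if m < card C then f m else {})" for m
  have VC: "V m \<in> C" if "m < card C" for m
    using f that by (auto simp: V_def bij_betw_def)
  have "A \<subseteq> (\<Union>m. V m)"
  proof
    fix x assume "x \<in> A"
    then obtain U where "U \<in> C" "x \<in> U" using assms(5) by auto
    then obtain m where "m < card C" "f m = U"
      using bij_betw_imp_surj_on[OF f] by (metis imageE lessThan_iff)
    then show "x \<in> (\<Union>m. V m)" using \<open>x \<in> U\<close> by (auto simp: V_def intro!: exI[of _ m])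
  qed
  moreover have "bounded (V m) \<and> diameter (V m) \<le> \<delta>" for m
    using C[OF VC[of m]] assms(2,3) by (cases "m < card C") (auto simp: V_def)
  ultimately have "V \<in> delta_covers \<delta> A" by (auto simp: delta_covers_def)
  then have "hausdorff_premeasure s \<delta> A \<le> (\<Sum>m. diam_pow s (V m))"
    unfolding hausdorff_premeasure_def by (rule INF_lower)
  also have "\<dots> = (\<Sum>m<card C. diam_pow s (V m))"
    by (rule suminf_finite) (auto simp: V_def diam_pow_def)
  also have "\<dots> \<le> (\<Sum>m<card C. ennreal (r powr s))"
    by (rule sum_mono) (use C VC assms in \<open>auto intro!: diam_pow_le\<close>)
  also have "\<dots> = ennreal (real (card C) * r powr s)"
    by (simp add: ennreal_mult ennreal_of_nat_eq_real_of_nat)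
  finally show ?thesis .
qed

text \<open>
  For \<open>s > ln M / ln b\<close> the ratio \<open>M / b powr s\<close> is below \<open>1\<close>, so the \<open>s\<close>-sums of the
  covers tend to \<open>0\<close>.
\<close>
lemma hausdorff_dim_le_of_geometric_covers:
  fixes C :: "nat \<Rightarrow> 'a::metric_space set set" and b M :: real
  assumes "1 < b" "1 \<le> M"
    and C: "\<And>n. finite (C n)" "\<And>n. A \<subseteq> \<Union>(C n)" "\<And>n. real (card (C n)) \<le> M ^ n"
    and diam: "\<And>n U. U \<in> C n \<Longrightarrow> bounded U \<and> diameter U \<le> 1 / b ^ n"
  shows "hausdorff_dim A \<le> ereal (ln M / ln b)"
proof (rule hausdorff_dim_leI)
  show "0 \<le> ln M / ln b" using assms(1,2) by simp
  fix s assume s: "ln M / ln b < s"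
  then have "0 < s" using \<open>0 \<le> ln M / ln b\<close> by linarith
  define \<rho> where "\<rho> = M / b powr s"
  have "ln M < s * ln b" using s assms(1) by (simp add: field_simps)
  then have "M < b powr s"
    using assms(1,2) by (subst ln_less_cancel_iff[symmetric]) (auto simp: ln_powr)
  then have \<rho>: "0 \<le> \<rho>" "\<rho> < 1" using assms(1,2) by (auto simp: \<rho>_def)
  have "hausdorff_premeasure s \<delta> A = 0" if "\<delta> > 0" for \<delta>
  proof -
    have "hausdorff_premeasure s \<delta> A \<le> ennreal (\<rho> ^ n)" if n: "(1 / b) ^ n < \<delta>" for n
    proof -
      have "hausdorff_premeasure s \<delta> A \<le> ennreal (real (card (C n)) * (1 / b ^ n) powr s)"
        by (rule hausdorff_premeasure_le_finite_cover)
          (use C diam \<open>0 < s\<close> n assms(1) in \<open>auto simp: power_divide\<close>)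
      also have "\<dots> \<le> ennreal (M ^ n * (1 / b ^ n) powr s)"
        by (intro ennreal_leI mult_right_mono C) auto
      also have "M ^ n * (1 / b ^ n) powr s = \<rho> ^ n"
        using assms(1)
        by (simp add: \<rho>_def power_divide powr_divide powr_realpow[symmetric] powr_powr mult.commute)
      finally show ?thesis .
    qed
    moreover have "\<forall>\<^sub>F n in sequentially. (1 / b) ^ n < \<delta>"
      using LIMSEQ_power_zero[of "1 / b"] assms(1) \<open>\<delta> > 0\<close> by (auto intro: order_tendstoD)
    ultimately have "\<forall>\<^sub>F n in sequentially. hausdorff_premeasure s \<delta> A \<le> ennreal (\<rho> ^ n)"
      by (auto elim: eventually_mono)
    moreover have "(\<lambda>n. ennreal (\<rho> ^ n)) \<longlonglongrightarrow> ennreal 0"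
      by (intro tendsto_ennrealI LIMSEQ_power_zero) (use \<rho> in auto)
    ultimately have "hausdorff_premeasure s \<delta> A \<le> ennreal 0"
      by (intro tendsto_lowerbound) auto
    then show ?thesis by simp
  qed
  then have "hausdorff_measure s A \<le> 0"
    unfolding hausdorff_measure_def by (intro SUP_least) auto
  then show "hausdorff_measure s A = 0" by simp
qed

text \<open>
  The preimage under \<open>h\<close> of a set of diameter \<open>d\<close> lies in an interval of length
  \<open>2 * K * d powr s\<close>. If the \<open>t\<close>-measure of \<open>A\<close> vanished for some \<open>t < s\<close>, there would be a
  cover of \<open>A\<close> by sets of diameter at most \<open>1\<close> with \<open>t\<close>-sum, and so also \<open>s\<close>-sum, below
  \<open>1 / (2 * K)\<close>, and the preimages could not cover the unit interval.
\<close>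
lemma hausdorff_dim_ge_of_inverse_Hoelder:
  fixes h :: "real \<Rightarrow> 'a::metric_space"
  assumes "0 < K" and hA: "h ` {0..<1} \<subseteq> A"
    and hol: "\<And>x y. x \<in> {0..<1} \<Longrightarrow> y \<in> {0..<1} \<Longrightarrow> \<bar>x - y\<bar> \<le> K * dist (h x) (h y) powr s"
  shows "ereal s \<le> hausdorff_dim A"
proof (rule hausdorff_dim_geI, rule ccontr)
  fix t assume t: "0 \<le> t" "hausdorff_measure t A = 0" "\<not> s \<le> t"
  have "hausdorff_premeasure t 1 A \<le> hausdorff_measure t A"
    unfolding hausdorff_measure_def by (rule SUP_upper) auto
  then have "hausdorff_premeasure t 1 A < ennreal (1 / (2 * K))"
    using t \<open>0 < K\<close> by simp
  then obtain U where U: "U \<in> delta_covers 1 A" "(\<Sum>n. diam_pow t (U n)) < ennreal (1 / (2 * K))"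
    unfolding hausdorff_premeasure_def by (auto simp: INF_less_iff)
  have Ub: "bounded (U n)" "diameter (U n) \<le> 1" for n using U by (auto simp: delta_covers_def)
  have UA: "A \<subseteq> (\<Union>n. U n)" using U by (auto simp: delta_covers_def)
  have "\<exists>W. W \<in> sets lborel \<and> h -` U n \<inter> {0..<1} \<subseteq> W \<and>
            emeasure lborel W \<le> ennreal (2 * K) * diam_pow t (U n)" for n
  proof (cases "h -` U n \<inter> {0..<1} = {}")
    case True
    then show ?thesis by (intro exI[of _ "{}"]) auto
  next
    case False
    then obtain v where v: "v \<in> {0..<1}" "h v \<in> U n" by blast
    define D where "D = K * diameter (U n) powr s"
    have d0: "0 \<le> diameter (U n)" by (rule diameter_ge_0[OF Ub(1)])
    have "h -` U n \<inter> {0..<1} \<subseteq> {v - D .. v + D}"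
    proof
      fix w assume w: "w \<in> h -` U n \<inter> {0..<1}"
      have "\<bar>w - v\<bar> \<le> K * dist (h w) (h v) powr s" using hol w v by auto
      also have "\<dots> \<le> D"
        unfolding D_def using w v t \<open>0 < K\<close> Ub
        by (intro mult_left_mono powr_mono2 diameter_bounded_bound) auto
      finally show "w \<in> {v - D .. v + D}" by auto
    qed
    moreover have "emeasure lborel {v - D .. v + D} \<le> ennreal (2 * K) * diam_pow t (U n)"
    proof -
      have "diameter (U n) powr s \<le> (if t = 0 then 1 else diameter (U n) powr t)"
        using d0 Ub(2)[of n] t by (auto intro: powr_le1 powr_mono')
      moreover have "diam_pow t (U n) = ennreal (if t = 0 then 1 else diameter (U n) powr t)"
        using v by (auto simp: diam_pow_def)
      ultimately have "ennreal (diameter (U n) powr s) \<le> diam_pow t (U n)"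
        by (simp add: ennreal_leI)
      then have "ennreal (2 * K) * ennreal (diameter (U n) powr s) \<le> ennreal (2 * K) * diam_pow t (U n)"
        by (rule mult_left_mono) auto
      moreover have "emeasure lborel {v - D .. v + D} = ennreal (2 * K) * ennreal (diameter (U n) powr s)"
        using \<open>0 < K\<close> by (simp add: D_def ennreal_mult[symmetric])
      ultimately show ?thesis by simp
    qed
    ultimately show ?thesis by (intro exI[of _ "{v - D .. v + D}"]) auto
  qed
  then obtain W where W: "W n \<in> sets lborel" "h -` U n \<inter> {0..<1} \<subseteq> W n"
      "emeasure lborel (W n) \<le> ennreal (2 * K) * diam_pow t (U n)" for n
    by metis
  have "{0..<1::real} \<subseteq> (\<Union>n. W n)"
  proof
    fix y :: real assume y: "y \<in> {0..<1}"
    then obtain n where "h y \<in> U n" using hA UA by blast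
    then show "y \<in> (\<Union>n. W n)" using y W(2)[of n] by auto
  qed
  then have "emeasure lborel {0..<1::real} \<le> emeasure lborel (\<Union>n. W n)"
    using W(1) by (intro emeasure_mono) auto
  also have "\<dots> \<le> (\<Sum>n. emeasure lborel (W n))"
    using W(1) by (intro emeasure_subadditive_countably) auto
  also have "\<dots> \<le> (\<Sum>n. ennreal (2 * K) * diam_pow t (U n))"
    by (intro suminf_le W) auto
  also have "\<dots> = ennreal (2 * K) * (\<Sum>n. diam_pow t (U n))" by simp
  also have "\<dots> < ennreal (2 * K) * ennreal (1 / (2 * K))"
    using U(2) \<open>0 < K\<close> by (intro ennreal_mult_strict_left_mono) auto
  also have "\<dots> = 1" using \<open>0 < K\<close> by (simp add: ennreal_mult[symmetric])
  finally show False by simp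
qed

section \<open>The upper bound\<close>

lemma floor_mult_eq: "\<lfloor>of_int m * x\<rfloor> = m * \<lfloor>x\<rfloor> + \<lfloor>of_int m * frac x\<rfloor>" for x :: real
proof -
  have "of_int m * x = of_int (m * \<lfloor>x\<rfloor>) + of_int m * frac x"
    by (simp add: frac_def algebra_simps)
  then show ?thesis by (metis add.commute floor_add_int)
qed

lemma frac_mult_frac: "frac (of_int m * frac x) = frac (of_int m * x)" for x :: real
proof -
  have "of_int m * x = of_int m * frac x + of_int (m * \<lfloor>x\<rfloor>)"
    by (simp add: frac_def algebra_simps)
  then show ?thesis by (simp add: frac_def)
qed

lemma floor_mult_frac_bounds:
  assumes "0 < m"
  shows "0 \<le> \<lfloor>of_int m * frac (x::real)\<rfloor>" "\<lfloor>of_int m * frac x\<rfloor> < m"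
  using assms frac_lt_1[of x] by (simp_all add: floor_less_iff)

text \<open>
  The integer \<open>\<lfloor>q ^ n * x\<rfloor>\<close> encodes the first \<open>n\<close> base-\<open>q\<close> digits of \<open>x\<close>. Passing to
  \<open>n + 1\<close> appends the leading digit of \<open>frac (q ^ n * x) \<ge> i / q\<close>, which is at least \<open>i\<close>.
\<close>
lemma prefixes_of_F:
  fixes q i :: int
  assumes "0 \<le> i" "i < q" and c: "real_of_int i / real_of_int q \<le> c"
  defines "P n \<equiv> (\<lambda>x. \<lfloor>real_of_int q ^ n * x\<rfloor>) ` F q c"
  shows "finite (P n) \<and> real (card (P n)) \<le> real_of_int (q - i) ^ n"
proof (induction n)
  case 0
  have "P 0 \<subseteq> {0}" by (auto simp: P_def F_def floor_eq_iff)
  then show ?case using finite_subset[of "P 0" "{0}"] card_mono[of "{0}" "P 0"] by auto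
next
  case (Suc n)
  have sub: "P (Suc n) \<subseteq> (\<lambda>(a, d). q * a + d) ` (P n \<times> {i..<q})"
  proof
    fix a assume "a \<in> P (Suc n)"
    then obtain x where x: "x \<in> F q c" and a: "a = \<lfloor>of_int q * (of_int q ^ n * x)\<rfloor>"
      by (auto simp: P_def mult.assoc)
    let ?d = "\<lfloor>of_int q * frac (of_int q ^ n * x)\<rfloor>"
    have "c \<le> frac (of_int q ^ n * x)" using x by (auto simp: F_def)
    then have "of_int i / of_int q \<le> frac (of_int q ^ n * x)" using c by linarith
    then have "i \<le> ?d" using assms(1,2) by (simp add: le_floor_iff field_simps)
    then have "?d \<in> {i..<q}" using floor_mult_frac_bounds(2)[of q] assms(1,2) by auto
    moreover have "a = q * \<lfloor>of_int q ^ n * x\<rfloor> + ?d" unfolding a by (rule floor_mult_eq)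
    ultimately show "a \<in> (\<lambda>(a, d). q * a + d) ` (P n \<times> {i..<q})"
      using x by (auto simp: P_def)
  qed
  have fin: "finite (P n \<times> {i..<q})" using Suc by auto
  have "card (P (Suc n)) \<le> card (P n \<times> {i..<q})"
    using surj_card_le[OF fin sub] .
  have "real (card (P (Suc n))) \<le> real (card (P n)) * of_int (q - i)"
  proof -
    have "real (card (P n \<times> {i..<q})) = real (card (P n)) * of_int (q - i)"
      using assms(2) by (simp add: card_cartesian_product)
    then show ?thesis using \<open>card (P (Suc n)) \<le> card (P n \<times> {i..<q})\<close>
      by (metis of_nat_mono)
  qed
  also have "\<dots> \<le> of_int (q - i) ^ n * of_int (q - i)"
    using Suc assms(1,2) by (intro mult_right_mono) auto
  finally show ?case using finite_subset[OF sub] fin by (simp add: mult.commute)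
qed

lemma dim_F_le:
  fixes q i :: int
  assumes "q \<ge> 2" "0 \<le> i" "i < q" and c: "real_of_int i / real_of_int q \<le> c"
  shows "hausdorff_dim (F q c) \<le> ereal (ln (real_of_int (q - i)) / ln (real_of_int q))"
proof (rule hausdorff_dim_le_of_geometric_covers)
  define P where "P n = (\<lambda>x. \<lfloor>real_of_int q ^ n * x\<rfloor>) ` F q c" for n
  define I where "I n a = {of_int a / real_of_int q ^ n .. (of_int a + 1) / real_of_int q ^ n}" for n a
  have P: "finite (P n)" "real (card (P n)) \<le> real_of_int (q - i) ^ n" for n
    using prefixes_of_F[OF assms(2-4), of n] by (auto simp: P_def)
  show "finite (I n ` P n)" for n using P by auto
  show "real (card (I n ` P n)) \<le> real_of_int (q - i) ^ n" for n
    using P[of n] card_image_le[of "P n" "I n"] by linarith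
  show "F q c \<subseteq> \<Union>(I n ` P n)" for n
  proof
    fix x assume "x \<in> F q c"
    moreover have "x \<in> I n \<lfloor>of_int q ^ n * x\<rfloor>"
      using assms(1) of_int_floor_le[of "of_int q ^ n * x"] 
        real_of_int_floor_add_one_ge[of "of_int q ^ n * x"]
      by (auto simp: I_def field_simps)
    ultimately show "x \<in> \<Union>(I n ` P n)" by (auto simp: P_def)
  qed
  show "bounded U \<and> diameter U \<le> 1 / real_of_int q ^ n" if "U \<in> I n ` P n" for n U
    using that assms(1) by (auto simp: I_def diameter_closed_interval field_simps)
qed (use assms in auto)

section \<open>The lower bound\<close>

text \<open>
  The bound \<open>i + 2 \<le> q\<close> leaves at least two digits, so that base \<open>q - i\<close> makes sense.
\<close>
locale digit_shift =
  fixes q i :: int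
  assumes i_nonneg: "0 \<le> i" and i_less: "i + 2 \<le> q"
begin

definition N :: int where "N = q - i"

lemma N_bounds: "2 \<le> N" "N \<le> q" "2 \<le> q"
  using i_nonneg i_less by (auto simp: N_def)

text \<open>
  The integer \<open>\<lfloor>N * frac (N ^ k * y)\<rfloor>\<close> is the digit number \<open>k\<close>, counted from \<open>0\<close>, in the
  standard base-\<open>N\<close> expansion of \<open>y\<close>.
\<close>
definition shifted :: "real \<Rightarrow> real" where
  "shifted y = (\<Sum>k. of_int (i + \<lfloor>of_int N * frac (of_int N ^ k * y)\<rfloor>) / of_int q ^ Suc k)"

lemma digit_bounds:
  "i \<le> i + \<lfloor>of_int N * frac (x::real)\<rfloor>" "i + \<lfloor>of_int N * frac x\<rfloor> \<le> q - 1"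
  using floor_mult_frac_bounds[of N x] N_bounds by (auto simp: N_def)

lemma sums_constant_digit: "(\<lambda>k. r / of_int q ^ Suc k) sums (r / (of_int q - 1))" for r :: real
proof -
  have "(\<lambda>k. (r / of_int q) * (1 / of_int q) ^ k) sums ((r / of_int q) * (1 / (1 - 1 / of_int q)))"
    using N_bounds by (intro sums_mult geometric_sums) auto
  moreover have "(r / of_int q) * (1 / (1 - 1 / of_int q)) = r / (of_int q - 1)"
    using N_bounds by (simp add: divide_simps)
  ultimately show ?thesis by (simp only: power_divide times_divide_times_eq mult_1_right power_one power_Suc)
qed

lemma summable_shifted:
  "summable (\<lambda>k. of_int (i + \<lfloor>of_int N * frac (of_int N ^ k * y)\<rfloor>) / real_of_int q ^ Suc k)"
  for y :: real
proof (rule summable_comparison_test')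
  show "summable (\<lambda>k. of_int (q - 1) / real_of_int q ^ Suc k)"
    using sums_constant_digit sums_summable by blast
  fix k :: nat
  let ?d = "i + \<lfloor>of_int N * frac (of_int N ^ k * y)\<rfloor>"
  have "0 \<le> ?d" "?d \<le> q - 1" using digit_bounds[of "of_int N ^ k * y"] i_nonneg by linarith+
  then have "0 \<le> real_of_int ?d" "real_of_int ?d \<le> of_int (q - 1)" by linarith+
  then show "norm (of_int ?d / real_of_int q ^ Suc k) \<le> of_int (q - 1) / real_of_int q ^ Suc k"
    using N_bounds by (simp del: of_int_add of_int_diff add: divide_right_mono)
qed

lemma shifted_ge: "of_int i / (of_int q - 1) \<le> shifted y"
  unfolding shifted_def sums_unique[OF sums_constant_digit]
proof (rule suminf_le[OF _ sums_summable[OF sums_constant_digit] summable_shifted])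
  fix k show "of_int i / real_of_int q ^ Suc k
      \<le> of_int (i + \<lfloor>of_int N * frac (of_int N ^ k * y)\<rfloor>) / of_int q ^ Suc k"
    using N_bounds digit_bounds(1)[of "of_int N ^ k * y"]
    by (intro divide_right_mono) (simp_all only: of_int_le_iff, auto)
qed

lemma shifted_nonneg: "0 \<le> shifted y"
proof -
  have "0 \<le> of_int i / (real_of_int q - 1)" using i_nonneg N_bounds by simp
  then show ?thesis using shifted_ge[of y] by linarith
qed

lemma shifted_le_1: "shifted y \<le> 1"
proof -
  have "shifted y \<le> (\<Sum>k. of_int (q - 1) / real_of_int q ^ Suc k)"
    unfolding shifted_def
  proof (rule suminf_le[OF _ summable_shifted sums_summable[OF sums_constant_digit]])
    fix k show "of_int (i + \<lfloor>of_int N * frac (of_int N ^ k * y)\<rfloor>) / of_int q ^ Suc k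
        \<le> of_int (q - 1) / real_of_int q ^ Suc k"
      using N_bounds digit_bounds(2)[of "of_int N ^ k * y"]
      by (intro divide_right_mono) (simp_all only: of_int_le_iff, auto)
  qed
  also have "\<dots> = 1" using sums_unique[OF sums_constant_digit, of "of_int (q - 1)"] N_bounds by simp
  finally show ?thesis .
qed

text \<open>
  Multiplying \<open>y\<close> by \<open>N\<close> and \<open>shifted y\<close> by \<open>q\<close> drops the first digit on both sides. Apart
  from the bounds on \<open>shifted\<close>, this self-similarity is the only property of the series used below.
\<close>
lemma shifted_step:
  assumes "y \<in> {0..<1}"
  shows "of_int q * shifted y = of_int (i + \<lfloor>of_int N * y\<rfloor>) + shifted (frac (of_int N * y))"
proof -
  let ?d = "\<lambda>k y. real_of_int (i + \<lfloor>of_int N * frac (of_int N ^ k * y)\<rfloor>)"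
  have fr: "frac y = y" using assms by (simp add: frac_eq)
  have "frac (of_int N ^ Suc k * y) = frac (of_int N ^ k * frac (of_int N * y))" for k
    using frac_mult_frac[of "N ^ k" "of_int N * y"] by (simp add: mult_ac)
  then have tail: "?d (Suc k) y / of_int q ^ Suc (Suc k)
      = (1 / of_int q) * (?d k (frac (of_int N * y)) / of_int q ^ Suc k)" for k
    by simp
  have "shifted y = ?d 0 y / of_int q + (\<Sum>k. ?d (Suc k) y / of_int q ^ Suc (Suc k))"
    unfolding shifted_def using suminf_split_head[OF summable_shifted, of y] by simp
  also have "(\<Sum>k. ?d (Suc k) y / of_int q ^ Suc (Suc k)) = (1 / of_int q) * shifted (frac (of_int N * y))"
    unfolding tail shifted_def by (rule suminf_mult[OF summable_shifted])
  finally show ?thesis using N_bounds fr by (simp add: field_simps)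
qed

text \<open>
  Strictness matters: where \<open>shifted y = 1\<close>, the fractional part would drop to \<open>0\<close>. It holds
  because the standard expansion of \<open>y < 1\<close> has a digit other than \<open>N - 1\<close>: as long as the leading
  digit is \<open>N - 1\<close>, dropping it multiplies the distance to \<open>1\<close> by \<open>N\<close>, which cannot go on.
\<close>
lemma shifted_less_1:
  assumes "y \<in> {0..<1}"
  shows "shifted y < 1"
proof -
  have ind: "shifted y < 1" if "y \<in> {0..<1}" "1 \<le> of_int N ^ n * (1 - y)" for n y
    using that
  proof (induction n arbitrary: y)
    case 0
    then have "y = 0" by auto
    then have "of_int q * shifted 0 = of_int i + shifted 0" using shifted_step[of 0] by simp
    then have "(of_int q - 1) * shifted 0 = of_int i" by (simp add: algebra_simps)
    then have "shifted 0 = of_int i / (of_int q - 1)" using N_bounds by (simp add: field_simps)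
    then show ?case using \<open>y = 0\<close> i_less N_bounds by simp
  next
    case (Suc n)
    have fr: "frac y = y" using Suc.prems by (simp add: frac_eq)
    have le: "\<lfloor>of_int N * y\<rfloor> \<le> N - 1"
      using digit_bounds(2)[of y] fr by (simp add: N_def)
    show ?case
    proof (cases "\<lfloor>of_int N * y\<rfloor> = N - 1")
      case True
      then have "1 - frac (of_int N * y) = of_int N * (1 - y)" by (simp add: frac_def algebra_simps)
      then have "shifted (frac (of_int N * y)) < 1"
        using Suc.prems(2) by (intro Suc.IH) (auto simp: frac_lt_1 mult_ac)
      then have "of_int q * shifted y < of_int q"
        using shifted_step[OF Suc.prems(1)] True by (simp add: N_def)
      then show ?thesis using N_bounds by simp
    next
      case False
      then have "i + \<lfloor>of_int N * y\<rfloor> \<le> q - 2" using le by (simp add: N_def)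
      then have "real_of_int (i + \<lfloor>of_int N * y\<rfloor>) \<le> of_int q - 2"
        by linarith
      then have "of_int q * shifted y < of_int q"
        using shifted_step[OF Suc.prems(1)] shifted_le_1[of "frac (of_int N * y)"] by linarith
      then show ?thesis using N_bounds by simp
    qed
  qed
  obtain n where "1 / (1 - y) < of_int N ^ n"
    using real_arch_pow[of "of_int N" "1 / (1 - y)"] N_bounds by auto
  then show ?thesis using assms by (intro ind[of y n]) (auto simp: field_simps)
qed

text \<open>
  The finite counterpart of \<open>shifted\<close>: the last \<open>n\<close> base-\<open>N\<close> digits of \<open>a\<close> are
  increased by \<open>i\<close> and read in base \<open>q\<close>. The base case keeps the remaining leading part
  instead of discarding it, so that \<open>reread_expanding\<close> already holds for \<open>n = 0\<close>.
\<close>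
primrec reread :: "nat \<Rightarrow> int \<Rightarrow> int" where
  "reread 0 a = a"
| "reread (Suc n) a = q * reread n (a div N) + i + a mod N"

text \<open>
  Here \<open>N \<le> q\<close> enters: a carry in base \<open>N\<close> becomes a step of size \<open>q\<close> in place of \<open>N\<close>.
\<close>
lemma reread_expanding:
  assumes "a \<le> b"
  shows "b - a \<le> reread n b - reread n a"
  using assms
proof (induction n arbitrary: a b)
  case (Suc n)
  have le: "a div N \<le> b div N" using Suc.prems N_bounds by (intro zdiv_mono1) auto
  have "N * (b div N - a div N) \<le> q * (b div N - a div N)"
    using le N_bounds by (intro mult_right_mono) auto
  also have "\<dots> \<le> q * (reread n (b div N) - reread n (a div N))"
    using Suc.IH[OF le] N_bounds by (intro mult_left_mono) auto
  finally have "N * (b div N) - N * (a div N) \<le> q * reread n (b div N) - q * reread n (a div N)"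
    by (simp add: algebra_simps)
  then show ?case
    using mult_div_mod_eq[of N a] mult_div_mod_eq[of N b] by (simp only: reread.simps)
qed simp

lemma shifted_iterate:
  assumes "y \<in> {0..<1}"
  shows "of_int q ^ n * shifted y = of_int (reread n \<lfloor>of_int N ^ n * y\<rfloor>) + shifted (frac (of_int N ^ n * y))"
proof (induction n)
  case 0
  then show ?case using assms by (simp add: frac_eq floor_eq_iff)
next
  case (Suc n)
  let ?z = "of_int N ^ n * y :: real"
  let ?d = "\<lfloor>of_int N * frac ?z\<rfloor>"
  have fl: "\<lfloor>of_int N ^ Suc n * y\<rfloor> = N * \<lfloor>?z\<rfloor> + ?d"
    using floor_mult_eq[of N ?z] by (simp add: mult.assoc)
  have d: "0 \<le> ?d" "?d < N" using floor_mult_frac_bounds[of N ?z] N_bounds by auto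
  have dm: "\<lfloor>of_int N ^ Suc n * y\<rfloor> div N = \<lfloor>?z\<rfloor>" "\<lfloor>of_int N ^ Suc n * y\<rfloor> mod N = ?d"
    unfolding fl using d by (simp_all add: div_pos_pos_trivial mod_pos_pos_trivial del: zero_le_floor)
  have "of_int q ^ Suc n * shifted y = of_int q * of_int (reread n \<lfloor>?z\<rfloor>) + of_int q * shifted (frac ?z)"
    using Suc by (simp add: mult.assoc distrib_left)
  also have "of_int q * shifted (frac ?z) = of_int (i + ?d) + shifted (frac (of_int N * frac ?z))"
    by (rule shifted_step) (simp add: frac_lt_1)
  also have "frac (of_int N * frac ?z) = frac (of_int N ^ Suc n * y)"
    by (simp add: frac_mult_frac mult.assoc)
  finally show ?case by (simp only: reread.simps dm) simp
qed

text \<open>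
  By \<open>shifted_iterate\<close> the orbit of \<open>shifted y\<close> under multiplication by \<open>q\<close> modulo \<open>1\<close> stays in
  the range of \<open>shifted\<close>, which is bounded below by \<open>0.iii... = i/(q-1)\<close>.
\<close>
lemma shifted_in_F:
  assumes "y \<in> {0..<1}" "c \<le> of_int i / (of_int q - 1)"
  shows "shifted y \<in> F q c"
proof -
  have "frac (of_int q ^ n * shifted y) = shifted (frac (of_int N ^ n * y))" for n
    unfolding shifted_iterate[OF assms(1)]
    using shifted_nonneg shifted_less_1[of "frac (of_int N ^ n * y)"] by (simp add: frac_lt_1 frac_unique_iff)
  then show ?thesis
    using shifted_nonneg shifted_less_1[OF assms(1)] assms(2) shifted_ge by (auto simp: F_def intro: order_trans)
qed

text \<open>
  If the images are closer than \<open>q ^ -n\<close>, their integer parts at scale \<open>q ^ n\<close> differ by at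
  most \<open>1\<close>. By \<open>reread_expanding\<close> the same is true of the integer parts of the arguments at scale
  \<open>N ^ n\<close>. Neighbouring cells cannot be excluded, hence \<open>2\<close> and not \<open>1\<close> in the conclusion.
\<close>
lemma shifted_separates:
  assumes "x \<in> {0..<1}" "y \<in> {0..<1}" "of_int q ^ n * \<bar>shifted x - shifted y\<bar> < 1"
  shows "of_int N ^ n * \<bar>x - y\<bar> < 2"
  using assms
proof (induction x y rule: linorder_wlog)
  case (le x y)
  let ?a = "\<lambda>y. \<lfloor>of_int N ^ n * y :: real\<rfloor>"
  let ?s = "\<lambda>y. shifted (frac (of_int N ^ n * y))"
  have "?a x \<le> ?a y" using le N_bounds by (intro floor_mono mult_left_mono) auto
  have "of_int q ^ n * (shifted y - shifted x) \<le> of_int q ^ n * \<bar>shifted x - shifted y\<bar>"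
    using N_bounds by (intro mult_left_mono) auto
  then have "of_int q ^ n * shifted y - of_int q ^ n * shifted x < 1"
    using le by (simp add: right_diff_distrib)
  moreover have "0 \<le> ?s y"
    by (rule shifted_nonneg)
  moreover have "?s x < 1" by (rule shifted_less_1) (simp add: frac_lt_1)
  ultimately have "reread n (?a y) - reread n (?a x) < 2"
    using shifted_iterate[OF le(2), of n] shifted_iterate[OF le(3), of n] by linarith
  then have "?a y - ?a x < 2" using reread_expanding[OF \<open>?a x \<le> ?a y\<close>, of n] by linarith
  then have "of_int N ^ n * y - of_int N ^ n * x < 2"
    by linarith
  then show ?case using le by (simp add: right_diff_distrib)
qed (simp add: abs_minus_commute)

text \<open>
  This is \<open>shifted_separates\<close> at the scale with \<open>q ^ -(n+1) \<le> d < q ^ -n\<close>, where \<open>d\<close> is the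
  distance of the images, rewritten with \<open>N = q powr (ln N / ln q)\<close>. The constant is \<open>2 * N\<close>
  and not \<open>2\<close> because \<open>d\<close> may be as small as \<open>q ^ -(n+1)\<close>.
\<close>
lemma inverse_Hoelder_shifted:
  assumes "x \<in> {0..<1}" "y \<in> {0..<1}"
  shows "\<bar>x - y\<bar> \<le> 2 * of_int N * dist (shifted x) (shifted y) powr (ln (of_int N) / ln (of_int q))"
proof -
  define s where "s = ln (real_of_int N) / ln (real_of_int q)"
  define d where "d = dist (shifted x) (shifted y)"
  have sep: "\<bar>x - y\<bar> < 2 / of_int N ^ n" if "of_int q ^ n * d < 1" for n
    using shifted_separates[OF assms, of n] that N_bounds by (simp add: d_def dist_real_def field_simps)
  have "d < 1"
    using shifted_nonneg[of x] shifted_nonneg[of y] shifted_less_1[OF assms(1)] shifted_less_1[OF assms(2)]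
    by (auto simp: d_def dist_real_def)
  show ?thesis
  proof (cases "d = 0")
    case True
    have "\<not> 0 < \<bar>x - y\<bar>"
    proof
      assume "0 < \<bar>x - y\<bar>"
      obtain n where "2 / \<bar>x - y\<bar> < of_int N ^ n"
        using real_arch_pow[of "of_int N" "2 / \<bar>x - y\<bar>"] N_bounds by auto
      then show False using sep[of n] True \<open>0 < \<bar>x - y\<bar>\<close> N_bounds by (simp add: field_simps)
    qed
    then show ?thesis using True by (simp add: d_def)
  next
    case False
    then have "0 < d" by (simp add: d_def)
    obtain m where "1 / d < of_int q ^ m"
      using real_arch_pow[of "of_int q" "1 / d"] N_bounds by auto
    then have m: "\<not> of_int q ^ m * d < 1" using \<open>0 < d\<close> by (simp add: field_simps)
    define k where "k = (LEAST m. \<not> of_int q ^ m * d < 1)"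
    have k: "1 \<le> of_int q ^ k * d" using LeastI[of "\<lambda>m. \<not> of_int q ^ m * d < 1", OF m] by (simp add: k_def)
    have "k \<noteq> 0" using k \<open>d < 1\<close> by (metis linorder_not_less mult_1 power_0)
    then obtain n where n: "k = Suc n" by (cases k) auto
    then have "of_int q ^ n * d < 1" using not_less_Least[of n "\<lambda>m. \<not> of_int q ^ m * d < 1"] by (simp add: k_def)
    then have "\<bar>x - y\<bar> \<le> 2 / of_int N ^ n" using sep by (simp add: less_imp_le)
    also have "\<dots> = 2 * of_int N * (1 / of_int N ^ k)" using N_bounds n by simp
    also have "1 / of_int N ^ k = (1 / of_int q ^ k) powr s"
    proof -
      have "of_int q powr s = of_int N" using N_bounds by (simp add: s_def powr_def)
      then show ?thesis
        using N_bounds by (simp add: powr_divide powr_realpow[symmetric] powr_powr mult.commute)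
          (simp add: powr_powr[symmetric] mult.commute)
    qed
    also have "2 * of_int N * \<dots> \<le> 2 * of_int N * d powr s"
      using N_bounds k by (intro mult_left_mono powr_mono2) (auto simp: s_def field_simps)
    finally show ?thesis by (simp add: s_def d_def)
  qed
qed

lemma dim_F_ge:
  assumes "c \<le> of_int i / (of_int q - 1)"
  shows "ereal (ln (of_int (q - i)) / ln (of_int q)) \<le> hausdorff_dim (F q c)"
  unfolding N_def[symmetric]
proof (rule hausdorff_dim_ge_of_inverse_Hoelder)
  show "shifted ` {0..<1} \<subseteq> F q c" using shifted_in_F assms by auto
qed (use inverse_Hoelder_shifted N_bounds in auto)

end

theorem mainTheorem4:
  fixes q i :: int
  assumes "q \<ge> 2" and "0 \<le> i" and "i < q"
  defines "J \<equiv> {real_of_int i / real_of_int q .. real_of_int i / (real_of_int q - 1)} \<inter> {0..<1}"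
  shows "phi q constant_on J \<and>
    (\<forall>c\<in>J. phi q c = ereal (ln (real_of_int q - real_of_int i) / ln (real_of_int q)))"
proof -
  have eq: "phi q c = ereal (ln (real_of_int q - real_of_int i) / ln (real_of_int q))" if "c \<in> J" for c
  proof (rule antisym)
    show "phi q c \<le> ereal (ln (real_of_int q - real_of_int i) / ln (real_of_int q))"
      using dim_F_le[of q i c] assms(1-3) that by (auto simp: phi_def J_def)
    show "ereal (ln (real_of_int q - real_of_int i) / ln (real_of_int q)) \<le> phi q c"
    proof (cases "i + 2 \<le> q")
      case True
      then interpret digit_shift q i using assms(2) by unfold_locales
      show ?thesis using dim_F_ge[of c] that by (auto simp: phi_def J_def)
    next
      case False
      then have "q = i + 1" using assms(3) by linarith
      then show ?thesis unfolding phi_def by (intro hausdorff_dim_geI) simp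
    qed
  qed
  then show ?thesis by (auto simp: constant_on_def)
qed

end
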